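(* Let $a,b,c$ be nonzero scalars and let $$A=aX+a^{-1}Y+qbc^{-1}(1-XY),\qquad B=bY+b^{-1}Z+qca^{-1}(1-YZ),$$ where $X,Y,Z$ are the equitable generators of $\mathfrak U_q(sl(2))$. Consider $A$ and $B$ as $q$-difference operators in $z$ through the realization of $\mathfrak U_q(sl(2))$ recalled in the context, and let $O$ be the operator of multiplication by $z$. Then $$A=\alpha\,O B+\beta\,B O+\gamma\,O+\delta$$ with $$\alpha=-\frac{q\left(q^{3/2+\nu}ab-q^{-3/2-\nu}c^{-1}\right)}{q^2-q^{-2}},\qquad \beta=\frac{q^{1/2+\nu}ab-q^{3/2-\nu}c^{-1}}{q^2-q^{-2}},$$ $$\gamma=bc^{-1}q^{3/2+\nu}+aq^{1/2-\nu},\qquad \delta=\frac{q^{2\nu+1}a+q^{-2\nu-1}a^{-1}+bc+b^{-1}c^{-1}}{q+q^{-1}} .$$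
   Context: $q\in\mathbb C\setminus\{0\}$ is not a root of unity, $\nu\in\mathbb C$ with $2\nu\notin\mathbb Z_{\ge0}$; values of $q^{1/2}$ and $q^\nu$ are fixed. $\mathfrak U_q(sl(2))$ is generated by $S_\pm$ and $q^{\pm s_3}$ with $q^{s_3}S_\pm=q^{\pm1}S_\pm q^{s_3}$, $[S_+,S_-]=\frac{q^{2s_3}-q^{-2s_3}}{q-q^{-1}}$. Equitable generators: $$X=q^{-2s_3}-(q-q^{-1})q^{1/2}S_+q^{-s_3},\qquad Y=q^{2s_3},\qquad Z=q^{-2s_3}+(1-q^{-2})q^{1/2}S_-q^{-s_3}.$$ Realization on formal power series in $z$, with $T_\pm f(z)=f(q^{\pm1}z)$: $$q^{s_3}\mapsto q^{-\nu}T_+,\quad q^{-s_3}\mapsto q^{\nu}T_-,\quad S_+\mapsto z\frac{q^{2\nu}T_--q^{-2\nu}T_+}{q-q^{-1}},\quad S_-\mapsto -z^{-1}\frac{T_--T_+}{q-q^{-1}} .$$ The paper writes $O=(q-q^{-1})q^{-\nu}S_+q^{s_3}(1-q^{-2\nu}q^{2s_3})^{-1}$, which in this realization is multiplication by $z$. *)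

theory Defs
  imports
    Complex_Main
    "HOL-Library.Poly_Mapping"
    "HOL-Computational_Algebra.Formal_Power_Series"
    "HOL-Algebra.Algebraic_Closure_Type"
begin

section \<open>Values of complex powers\<close>

text \<open>
  \<open>w\<close> is one of the values of \<open>q\<^sup>s\<close>, for an arbitrary branch of the logarithm.
\<close>

definition is_cpow_value :: "complex \<Rightarrow> complex \<Rightarrow> complex \<Rightarrow> bool" where
  "is_cpow_value q s w \<longleftrightarrow> (\<exists>l. exp l = q \<and> w = exp (s * l))"

text \<open>
  With \<open>qh\<close> the fixed value of \<open>q\<close> to the power \<open>1/2\<close> and \<open>qn\<close> that of \<open>q\<close> to the power \<open>\<nu>\<close>,
  \<open>qpow qh qn i j\<close> is \<open>q\<close> to the power \<open>i/2 + j \<nu>\<close>.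
\<close>

definition qpow :: "complex \<Rightarrow> complex \<Rightarrow> int \<Rightarrow> int \<Rightarrow> complex" where
  "qpow qh qn i j = qh powi i * qn powi j"


section \<open>The free algebra and \<open>U\<^sub>q(sl(2))\<close>\<close>

text \<open>
  Words form a monoid under concatenation; it is written additively because the product of
  \<^typ>\<open>'a \<Rightarrow>\<^sub>0 'b\<close> is the convolution over an additive monoid. So \<open>uq_gen list \<Rightarrow>\<^sub>0 complex\<close>, with
  its ring operations, is the free unital associative complex algebra on \<open>uq_gen\<close>.
\<close>

instantiation list :: (type) monoid_add
begin

definition zero_list :: "'a list" where "zero_list = []"

definition plus_list :: "'a list \<Rightarrow> 'a list \<Rightarrow> 'a list" where "plus_list xs ys = xs @ ys"

instance by standard (simp_all add: zero_list_def plus_list_def)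

end

text \<open>The letters stand for \<open>S\<^sub>+\<close>, \<open>S\<^sub>-\<close>, \<open>q\<close> to the power \<open>s\<^sub>3\<close> and \<open>q\<close> to the power \<open>-s\<^sub>3\<close>.\<close>

datatype uq_gen = Splus | Sminus | Qs3 | Qs3inv

type_synonym uq_free = "uq_gen list \<Rightarrow>\<^sub>0 complex"

definition free_gen :: "uq_gen \<Rightarrow> uq_free" where
  "free_gen g = Poly_Mapping.single [g] 1"

definition free_const :: "complex \<Rightarrow> uq_free" where
  "free_const c = Poly_Mapping.single [] c"

definition uq_relators :: "complex \<Rightarrow> uq_free set" where
  "uq_relators q =
     (let Sp = free_gen Splus; Sm = free_gen Sminus; K = free_gen Qs3; Ki = free_gen Qs3inv in
      {K * Ki - 1,
       Ki * K - 1,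
       K * Sp - free_const q * Sp * K,
       K * Sm - free_const (inverse q) * Sm * K,
       (Sp * Sm - Sm * Sp) - free_const (1 / (q - inverse q)) * (K * K - Ki * Ki)})"

definition uq_ideal :: "complex \<Rightarrow> uq_free set" where
  "uq_ideal q = Idl\<^bsub>(ring_of_type_algebra :: uq_free ring)\<^esub> (uq_relators q)"

definition uq_class :: "complex \<Rightarrow> uq_free \<Rightarrow> uq_free set" where
  "uq_class q p = uq_ideal q +>\<^bsub>(ring_of_type_algebra :: uq_free ring)\<^esub> p"

text \<open>
  The \<open>module\<close> record is used only for its scalar multiplication field; as a ring \<open>Uq q\<close> is the
  quotient ring.
\<close>

definition Uq :: "complex \<Rightarrow> (complex, uq_free set) module" where
  "Uq q =
     (let Q = (ring_of_type_algebra :: uq_free ring) Quot uq_ideal q in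
      \<lparr>carrier = carrier Q, monoid.mult = monoid.mult Q, one = \<one>\<^bsub>Q\<^esub>, ring.zero = \<zero>\<^bsub>Q\<^esub>,
       add = add Q,
       module.smult = (\<lambda>c x. uq_class q (free_const c) \<otimes>\<^bsub>Q\<^esub> x)\<rparr>)"


section \<open>Equitable generators\<close>

definition equit_X :: "complex \<Rightarrow> complex \<Rightarrow> uq_free set" where
  "equit_X q qh =
     (let U = Uq q; Sp = uq_class q (free_gen Splus); Ki = uq_class q (free_gen Qs3inv) in
      Ki \<otimes>\<^bsub>U\<^esub> Ki \<ominus>\<^bsub>U\<^esub> ((q - inverse q) * qh) \<odot>\<^bsub>U\<^esub> (Sp \<otimes>\<^bsub>U\<^esub> Ki))"

definition equit_Y :: "complex \<Rightarrow> uq_free set" where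
  "equit_Y q = (let U = Uq q; K = uq_class q (free_gen Qs3) in K \<otimes>\<^bsub>U\<^esub> K)"

definition equit_Z :: "complex \<Rightarrow> complex \<Rightarrow> uq_free set" where
  "equit_Z q qh =
     (let U = Uq q; Sm = uq_class q (free_gen Sminus); Ki = uq_class q (free_gen Qs3inv) in
      Ki \<otimes>\<^bsub>U\<^esub> Ki \<oplus>\<^bsub>U\<^esub> ((1 - inverse (q\<^sup>2)) * qh) \<odot>\<^bsub>U\<^esub> (Sm \<otimes>\<^bsub>U\<^esub> Ki))"


section \<open>Realization by \<open>q\<close>-difference operators\<close>

text \<open>\<open>fps_dilate c f\<close> is the series \<open>f(c z)\<close>, so \<open>T\<^sub>+\<close> is \<open>fps_dilate q\<close>.\<close>

definition fps_dilate :: "complex \<Rightarrow> complex fps \<Rightarrow> complex fps" where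
  "fps_dilate c f = fps_compose f (fps_const c * fps_X)"

text \<open>
  The series \<open>T\<^sub>- f - T\<^sub>+ f\<close> has constant term 0, so in the last equation \<^term>\<open>fps_shift 1\<close> is the
  division by \<open>z\<close>.
\<close>

fun gen_op :: "complex \<Rightarrow> complex \<Rightarrow> uq_gen \<Rightarrow> complex fps \<Rightarrow> complex fps" where
  "gen_op q qn Qs3 f = fps_const (inverse qn) * fps_dilate q f"
| "gen_op q qn Qs3inv f = fps_const qn * fps_dilate (inverse q) f"
| "gen_op q qn Splus f =
     fps_X * (fps_const (1 / (q - inverse q)) *
       (fps_const (qn\<^sup>2) * fps_dilate (inverse q) f - fps_const (inverse (qn\<^sup>2)) * fps_dilate q f))"
| "gen_op q qn Sminus f =
     - fps_shift 1 (fps_const (1 / (q - inverse q)) *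
       (fps_dilate (inverse q) f - fps_dilate q f))"

definition free_op :: "complex \<Rightarrow> complex \<Rightarrow> uq_free \<Rightarrow> complex fps \<Rightarrow> complex fps" where
  "free_op q qn p f =
     (\<Sum>w\<in>Poly_Mapping.keys p. fps_const (Poly_Mapping.lookup p w) * foldr (gen_op q qn) w f)"

text \<open>
  An element of \<open>Uq q\<close> is a coset, and all its members induce the same operator: this is
  \<open>uq_op_class\<close> below.
\<close>

definition uq_op :: "complex \<Rightarrow> complex \<Rightarrow> uq_free set \<Rightarrow> complex fps \<Rightarrow> complex fps" where
  "uq_op q qn x = the_elem (free_op q qn ` x)"


subsection \<open>The realization is well defined\<close>

lemma fps_dilate_nth [simp]: "fps_nth (fps_dilate c f) n = c ^ n * fps_nth f n"
  by (simp add: fps_dilate_def fps_compose_linear)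

lemma gen_op_0 [simp]: "gen_op q qn g 0 = 0"
  by (cases g) (auto simp: fps_eq_iff)

lemma gen_op_add: "gen_op q qn g (f1 + f2) = gen_op q qn g f1 + gen_op q qn g f2"
  by (cases g) (simp_all add: fps_eq_iff algebra_simps)

lemma gen_op_const: "gen_op q qn g (fps_const c * f) = fps_const c * gen_op q qn g f"
  by (cases g) (simp_all add: fps_eq_iff algebra_simps)

lemma word_op_0 [simp]: "foldr (gen_op q qn) w 0 = 0"
  by (induction w) simp_all

lemma word_op_add:
  "foldr (gen_op q qn) w (f1 + f2) = foldr (gen_op q qn) w f1 + foldr (gen_op q qn) w f2"
  by (induction w) (simp_all add: gen_op_add)

lemma word_op_const:
  "foldr (gen_op q qn) w (fps_const c * f) = fps_const c * foldr (gen_op q qn) w f"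
  by (induction w) (simp_all add: gen_op_const)

lemma word_op_sum:
  "foldr (gen_op q qn) w (sum F A) = (\<Sum>x\<in>A. foldr (gen_op q qn) w (F x))"
  by (induction A rule: infinite_finite_induct) (simp_all add: word_op_add)

lemma free_op_superset:
  assumes "finite W" "Poly_Mapping.keys p \<subseteq> W"
  shows "free_op q qn p f =
    (\<Sum>w\<in>W. fps_const (Poly_Mapping.lookup p w) * foldr (gen_op q qn) w f)"
  unfolding free_op_def
  by (rule sum.mono_neutral_left) (use assms in \<open>auto simp: in_keys_iff\<close>)

lemma free_op_zero [simp]: "free_op q qn 0 f = 0"
  by (simp add: free_op_def)

lemma free_op_at_0: "free_op q qn p 0 = 0"
  by (simp add: free_op_def)

lemma free_op_add: "free_op q qn (p + r) f = free_op q qn p f + free_op q qn r f"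
proof -
  let ?W = "Poly_Mapping.keys p \<union> Poly_Mapping.keys r"
  have "Poly_Mapping.keys (p + r) \<subseteq> ?W" by (rule Poly_Mapping.keys_add)
  then show ?thesis
    by (simp add: free_op_superset[of ?W] lookup_add sum.distrib distrib_right
        flip: fps_const_add)
qed

lemma free_op_uminus: "free_op q qn (- p) f = - free_op q qn p f"
  using free_op_add[of q qn p "- p" f] by (simp add: eq_neg_iff_add_eq_0 add.commute)

lemma free_op_diff: "free_op q qn (p - r) f = free_op q qn p f - free_op q qn r f"
  using free_op_add[of q qn p "- r" f] by (simp add: free_op_uminus)

lemma free_op_sum: "free_op q qn (sum F A) f = (\<Sum>x\<in>A. free_op q qn (F x) f)"
  by (induction A rule: infinite_finite_induct) (simp_all add: free_op_add)

lemma free_op_single: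
  "free_op q qn (Poly_Mapping.single w c) f = fps_const c * foldr (gen_op q qn) w f"
  by (cases "c = 0") (simp_all add: free_op_def)

lemma free_op_one [simp]: "free_op q qn 1 f = f"
  using free_op_single[of q qn 0 1 f] by (simp only: single_one) (simp add: zero_list_def)

lemma free_op_const [simp]: "free_op q qn (free_const c) f = fps_const c * f"
  by (simp add: free_const_def free_op_single)

lemma free_op_gen [simp]: "free_op q qn (free_gen g) f = gen_op q qn g f"
  by (simp add: free_gen_def free_op_single)

lemma sum_singles:
  fixes p :: "'a \<Rightarrow>\<^sub>0 'b::comm_monoid_add"
  shows "p = (\<Sum>w\<in>Poly_Mapping.keys p. Poly_Mapping.single w (Poly_Mapping.lookup p w))"
  by (rule poly_mapping_eqI)
    (simp add: lookup_sum lookup_single when_def sum.delta in_keys_iff)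

lemma free_op_mult: "free_op q qn (p * r) f = free_op q qn p (free_op q qn r f)"
proof -
  define P where "P w = Poly_Mapping.single w (Poly_Mapping.lookup p w)" for w
  define R where "R w = Poly_Mapping.single w (Poly_Mapping.lookup r w)" for w
  have 1: "free_op q qn (P w * R v) f = free_op q qn (P w) (free_op q qn (R v) f)" for w v
    by (simp add: P_def R_def mult_single free_op_single word_op_const plus_list_def
        mult.assoc flip: fps_const_mult)
  have 2: "free_op q qn (P w) (sum F A) = (\<Sum>x\<in>A. free_op q qn (P w) (F x))"
    for w F and A :: "uq_gen list set"
    by (simp add: P_def free_op_single word_op_sum sum_distrib_left)
  have p: "p = sum P (Poly_Mapping.keys p)" and r: "r = sum R (Poly_Mapping.keys r)"
    unfolding P_def R_def by (rule sum_singles)+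
  show ?thesis
    by (subst (1 2) p, subst (1 2) r) (simp add: sum_product free_op_sum 1 2)
qed

lemma relators_op:
  assumes "q \<noteq> 0" "qn \<noteq> 0" "q\<^sup>2 \<noteq> 1" "p \<in> uq_relators q"
  shows "free_op q qn p f = 0"
proof -
  have d: "q - inverse q \<noteq> 0"
    using assms(1,3) by (auto simp: field_simps power2_eq_square)
  have 1: "gen_op q qn Qs3 (gen_op q qn Qs3inv f) = f"
    "gen_op q qn Qs3inv (gen_op q qn Qs3 f) = f"
    using assms(1,2) by (simp_all add: fps_eq_iff field_simps)
  have 2: "gen_op q qn Qs3 (gen_op q qn Splus f) =
      fps_const q * gen_op q qn Splus (gen_op q qn Qs3 f)"
  proof (rule fps_ext)
    fix n
    show "fps_nth (gen_op q qn Qs3 (gen_op q qn Splus f)) n =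
      fps_nth (fps_const q * gen_op q qn Splus (gen_op q qn Qs3 f)) n"
      using assms(1,2) by (cases n) (simp_all add: algebra_simps)
  qed
  have c: "q * (inverse q * x) = x" for x
    using assms(1) by simp
  have 3: "gen_op q qn Qs3 (gen_op q qn Sminus f) =
      fps_const (inverse q) * gen_op q qn Sminus (gen_op q qn Qs3 f)"
    using assms(1) by (simp add: fps_eq_iff right_diff_distrib mult.assoc mult.left_commute c)
  have 4: "gen_op q qn Splus (gen_op q qn Sminus f) - gen_op q qn Sminus (gen_op q qn Splus f) =
    fps_const (1 / (q - inverse q)) * (gen_op q qn Qs3 (gen_op q qn Qs3 f) -
      gen_op q qn Qs3inv (gen_op q qn Qs3inv f))"
  proof (rule fps_ext)
    fix n
    define e where "e = 1 / (q - inverse q)"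
    define iq where "iq = inverse q"
    define v where "v = qn\<^sup>2"
    define iv where "iv = inverse (qn\<^sup>2)"
    define P where "P = q ^ n"
    define iP where "iP = iq ^ n"
    have e: "e * (q - iq) = 1" using d by (simp add: e_def iq_def)
    have q: "q * iq = 1" using assms(1) by (simp add: iq_def)
    have plus: "fps_nth (gen_op q qn Splus g) m =
        (if m = 0 then 0 else e * (v * iq ^ (m - 1) - iv * q ^ (m - 1)) * fps_nth g (m - 1))"
      for g m
      by (cases m) (simp_all add: e_def iq_def v_def iv_def algebra_simps)
    have minus: "fps_nth (gen_op q qn Sminus g) m =
        e * (q ^ (m + 1) - iq ^ (m + 1)) * fps_nth g (m + 1)" for g m
      by (simp add: e_def iq_def algebra_simps)
    have r: "fps_nth (fps_const (1 / (q - inverse q)) * (gen_op q qn Qs3 (gen_op q qn Qs3 f) -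
        gen_op q qn Qs3inv (gen_op q qn Qs3inv f))) n =
        e * (iv * P * P - v * iP * iP) * fps_nth f n"
      by (simp add: e_def iq_def v_def iv_def P_def iP_def power2_eq_square algebra_simps)
    have pm: "fps_nth (gen_op q qn Splus (gen_op q qn Sminus f)) n =
        e * e * ((v * q * iP - iv * iq * P) * (P - iP)) * fps_nth f n"
    proof (cases n)
      case 0
      then show ?thesis by (simp add: plus P_def iP_def del: gen_op.simps)
    next
      case (Suc m)
      have "q * iP = iq ^ m" "iq * P = q ^ m"
        using q by (simp_all add: Suc P_def iP_def mult.commute flip: mult.assoc)
      then have h: "v * q * iP = v * iq ^ m" "iv * iq * P = iv * q ^ m" by simp_all
      show ?thesis unfolding h by (simp add: plus minus Suc P_def iP_def del: gen_op.simps)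
    qed
    have mp: "fps_nth (gen_op q qn Sminus (gen_op q qn Splus f)) n =
        e * e * ((q * P - iq * iP) * (v * iP - iv * P)) * fps_nth f n"
      by (simp add: plus minus P_def iP_def del: gen_op.simps)
    have k: "(v * q * iP - iv * iq * P) * (P - iP) - (q * P - iq * iP) * (v * iP - iv * P) =
        (q - iq) * (iv * P * P - v * iP * iP)"
      by (simp add: algebra_simps)
    have key: "e * e * ((v * q * iP - iv * iq * P) * (P - iP)) -
        e * e * ((q * P - iq * iP) * (v * iP - iv * P)) = e * (iv * P * P - v * iP * iP)"
      unfolding right_diff_distrib[symmetric] k using e by (metis mult.assoc mult_1_right)
    show "fps_nth (gen_op q qn Splus (gen_op q qn Sminus f) -
        gen_op q qn Sminus (gen_op q qn Splus f)) n =
      fps_nth (fps_const (1 / (q - inverse q)) * (gen_op q qn Qs3 (gen_op q qn Qs3 f) -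
        gen_op q qn Qs3inv (gen_op q qn Qs3inv f))) n"
      unfolding r fps_sub_nth pm mp left_diff_distrib[symmetric] key ..
  qed
  show ?thesis
    using assms(4)
    by (auto simp: uq_relators_def Let_def free_op_diff free_op_mult 1 2 3 4 mult.assoc
        simp del: gen_op.simps)
qed

lemma ring_free: "ring (ring_of_type_algebra :: uq_free ring)"
proof -
  have "\<exists>y. x + y = 0" for x :: uq_free
    using add.right_inverse by blast
  then show ?thesis
    unfolding ring_of_type_algebra_def using add.right_inverse
    by unfold_locales (auto simp: algebra_simps Units_def)
qed

lemma uq_ideal_ideal: "ideal (uq_ideal q) (ring_of_type_algebra :: uq_free ring)"
  unfolding uq_ideal_def
  by (rule ring.genideal_ideal[OF ring_free]) (simp add: ring_of_type_algebra_def)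

lemma uq_ideal_op:
  assumes "q \<noteq> 0" "qn \<noteq> 0" "q\<^sup>2 \<noteq> 1" "p \<in> uq_ideal q"
  shows "free_op q qn p f = 0"
proof -
  let ?R = "ring_of_type_algebra :: uq_free ring"
  let ?K = "{p. \<forall>f. free_op q qn p f = 0}"
  have neg: "\<ominus>\<^bsub>?R\<^esub> x = - x" for x
    by (rule abelian_group.minus_equality[OF ring.is_abelian_group[OF ring_free]])
      (simp_all add: ring_of_type_algebra_def)
  have "ideal ?K ?R"
  proof (rule idealI[OF ring_free])
    have G: "group (add_monoid ?R)"
      by (rule abelian_group.a_group[OF ring.is_abelian_group[OF ring_free]])
    show "subgroup ?K (add_monoid ?R)"
    proof (rule group.subgroupI[OF G])
      show "?K \<noteq> {}" using free_op_zero by blast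
      show "inv\<^bsub>add_monoid ?R\<^esub> x \<in> ?K" if "x \<in> ?K" for x
        using that neg[of x] by (simp add: a_inv_def m_inv_def free_op_uminus)
    qed (simp_all add: ring_of_type_algebra_def free_op_add)
  qed (auto simp: ring_of_type_algebra_def free_op_mult free_op_at_0)
  moreover have "uq_relators q \<subseteq> ?K"
    using relators_op[OF assms(1-3)] by blast
  ultimately have "uq_ideal q \<subseteq> ?K"
    unfolding uq_ideal_def by (rule ring.genideal_minimal[OF ring_free])
  with assms(4) show ?thesis by blast
qed

lemma uq_op_class:
  assumes "q \<noteq> 0" "qn \<noteq> 0" "q\<^sup>2 \<noteq> 1"
  shows "uq_op q qn (uq_class q p) = free_op q qn p"
proof -
  have "free_op q qn ` uq_class q p = {free_op q qn p}"
  proof -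
    have "uq_class q p = (\<lambda>i. i + p) ` uq_ideal q"
      by (auto simp: uq_class_def a_r_coset_def r_coset_def ring_of_type_algebra_def)
    moreover have "free_op q qn (i + p) = free_op q qn p" if "i \<in> uq_ideal q" for i
      using uq_ideal_op[OF assms that] by (simp add: fun_eq_iff free_op_add)
    moreover have "uq_ideal q \<noteq> {}"
      using additive_subgroup.zero_closed[OF ideal.axioms(1)[OF uq_ideal_ideal]] by blast
    ultimately show ?thesis by (auto simp: image_iff)
  qed
  then show ?thesis by (simp add: uq_op_def)
qed

lemma Uq_class_mult: "uq_class q p \<otimes>\<^bsub>Uq q\<^esub> uq_class q r = uq_class q (p * r)"
  using ideal.rcoset_mult_add[OF uq_ideal_ideal, of p r q]
  by (simp add: Uq_def Let_def FactRing_def uq_class_def) (simp add: ring_of_type_algebra_def)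

lemma Uq_class_smult: "c \<odot>\<^bsub>Uq q\<^esub> uq_class q p = uq_class q (free_const c * p)"
  using Uq_class_mult[of q "free_const c" p] by (simp add: Uq_def Let_def)

lemma Uq_class_one: "\<one>\<^bsub>Uq q\<^esub> = uq_class q 1"
  by (simp add: Uq_def Let_def FactRing_def uq_class_def) (simp add: ring_of_type_algebra_def)

lemma Uq_class_add: "uq_class q p \<oplus>\<^bsub>Uq q\<^esub> uq_class q r = uq_class q (p + r)"
  using abelian_subgroup.a_rcos_sum[OF abelian_subgroupI3[OF ideal.axioms(1)[OF uq_ideal_ideal]
    ring.is_abelian_group[OF ring_free]], of p r q]
  by (simp add: Uq_def Let_def FactRing_def uq_class_def) (simp add: ring_of_type_algebra_def)

lemma Uq_class_diff: "uq_class q p \<ominus>\<^bsub>Uq q\<^esub> uq_class q r = uq_class q (p - r)"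
proof -
  let ?R = "ring_of_type_algebra :: uq_free ring"
  let ?Q = "?R Quot uq_ideal q"
  have Q: "ring ?Q" by (rule ideal.quotient_is_ring[OF uq_ideal_ideal])
  have car: "uq_class q x \<in> carrier ?Q" for x
    by (auto simp: uq_class_def FactRing_def A_RCOSETS_def' ring_of_type_algebra_def)
  have zero: "\<zero>\<^bsub>?Q\<^esub> = uq_class q 0"
    by (simp add: FactRing_def uq_class_def a_r_coset_def r_coset_def ring_of_type_algebra_def)
  have add: "uq_class q x \<oplus>\<^bsub>?Q\<^esub> uq_class q y = uq_class q (x + y)" for x y
    using Uq_class_add[of q x y] by (simp add: Uq_def Let_def)
  have "\<ominus>\<^bsub>?Q\<^esub> uq_class q r = uq_class q (- r)"
    by (rule abelian_group.minus_equality[OF ring.is_abelian_group[OF Q]])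
      (simp_all add: car add zero)
  moreover have "uq_class q p \<ominus>\<^bsub>Uq q\<^esub> uq_class q r = uq_class q p \<oplus>\<^bsub>?Q\<^esub> (\<ominus>\<^bsub>?Q\<^esub> uq_class q r)"
    by (simp add: a_minus_def a_inv_def m_inv_def Uq_def Let_def)
  ultimately show ?thesis by (simp add: add)
qed

end

theory Submission
  imports Defs
begin

text \<open>
  The operators \<open>A\<close> and \<open>B\<close> are bidiagonal on the monomials: \<open>A\<close> maps \<open>z\<^sup>n\<close> into the span of
  \<open>z\<^sup>n\<close> and \<open>z\<^sup>n\<^sup>+\<^sup>1\<close>, and \<open>B\<close> maps it into the span of \<open>z\<^sup>n\<close> and \<open>z\<^sup>n\<^sup>-\<^sup>1\<close>. Their matrix entries
  are Laurent polynomials in \<open>x = q\<^sup>2\<^sup>n\<close> with terms in \<open>x\<close>, \<open>1\<close> and \<open>1/x\<close> only. Comparing the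
  coefficients of \<open>x\<close> and \<open>1/x\<close>, above and on the diagonal, gives twice the same pair of equations
  \<open>\<alpha> + q\<^sup>2 \<beta> = - q\<^sup>3\<^sup>/\<^sup>2\<^sup>-\<^sup>\<nu> / c\<close> and \<open>\<alpha> + q\<^sup>-\<^sup>2 \<beta> = - q\<^sup>1\<^sup>/\<^sup>2\<^sup>+\<^sup>\<nu> a b\<close>; the terms free of \<open>x\<close>
  give \<open>\<gamma>\<close> and \<open>\<delta>\<close>.
\<close>

section \<open>Values of powers, and representatives of the equitable generators\<close>

lemma is_cpow_value_nonzero: "is_cpow_value q s w \<Longrightarrow> w \<noteq> 0"
  by (auto simp: is_cpow_value_def)

lemma is_cpow_value_half_square:
  assumes "is_cpow_value q (1/2) w"
  shows "w\<^sup>2 = q"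
  using assms by (auto simp: is_cpow_value_def simp flip: exp_double)

text \<open>Exhibits a representative in the free algebra, so that \<open>uq_op_class\<close> can
  turn the coset into an operator. The same is done for Y and Z.\<close>

lemma equit_X_class:
  "equit_X q qh = uq_class q (free_gen Qs3inv * free_gen Qs3inv -
     free_const ((q - inverse q) * qh) * (free_gen Splus * free_gen Qs3inv))"
  by (simp add: equit_X_def Let_def Uq_class_mult Uq_class_smult Uq_class_diff)

lemma equit_Y_class: "equit_Y q = uq_class q (free_gen Qs3 * free_gen Qs3)"
  by (simp add: equit_Y_def Let_def Uq_class_mult)

lemma equit_Z_class:
  "equit_Z q qh = uq_class q (free_gen Qs3inv * free_gen Qs3inv +
     free_const ((1 - inverse (q\<^sup>2)) * qh) * (free_gen Sminus * free_gen Qs3inv))"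
  by (simp add: equit_Z_def Let_def Uq_class_mult Uq_class_smult Uq_class_add)

section \<open>Matrix entries of X, Y, Z, 1 - XY and 1 - YZ\<close>

lemma uq_op_equit_X_nth:
  assumes "q \<noteq> 0" "qn \<noteq> 0" "q\<^sup>2 \<noteq> 1"
  shows "fps_nth (uq_op q qn (equit_X q qh) f) n = qn\<^sup>2 / q ^ (2 * n) * fps_nth f n -
    (if n = 0 then 0
     else qh * (qn ^ 3 / q ^ (2 * (n - 1)) - 1 / qn) * fps_nth f (n - 1))"
proof -
  have e: "(q - inverse q) * (1 / (q - inverse q)) = 1"
    using assms by (simp add: field_simps power2_eq_square)
  \<comment> \<open>The factor \<open>q - inverse q\<close> of X meets the denominator of the
    operator for S_+. Their product is kept unevaluated here so that \<open>e\<close> can cancel it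
    afterwards.\<close>
  have "fps_nth (uq_op q qn (equit_X q qh) f) n =
    qn\<^sup>2 * inverse (q ^ n) * inverse (q ^ n) * fps_nth f n - (if n = 0 then 0
     else ((q - inverse q) * (1 / (q - inverse q))) * qh * qn * inverse (q ^ (n - 1)) *
       (qn\<^sup>2 * inverse (q ^ (n - 1)) - inverse (qn\<^sup>2) * q ^ (n - 1)) * fps_nth f (n - 1))"
    unfolding equit_X_class uq_op_class[OF assms]
    by (cases n) (simp_all add: free_op_diff free_op_mult power_inverse power2_eq_square
      algebra_simps del: times_divide_eq_right mult_1_right right_inverse)
  also have "\<dots> = qn\<^sup>2 / q ^ (2 * n) * fps_nth f n -
    (if n = 0 then 0
     else qh * (qn ^ 3 / q ^ (2 * (n - 1)) - 1 / qn) * fps_nth f (n - 1))"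
    unfolding e mult_2 power_add using assms(1,2)
    by (simp add: field_simps power2_eq_square power3_eq_cube)
  finally show ?thesis .
qed

lemma uq_op_equit_Y_nth:
  assumes "q \<noteq> 0" "qn \<noteq> 0" "q\<^sup>2 \<noteq> 1"
  shows "fps_nth (uq_op q qn (equit_Y q) f) n = q ^ (2 * n) / qn\<^sup>2 * fps_nth f n"
  unfolding equit_Y_class uq_op_class[OF assms] mult_2 power_add
  using assms(1,2) by (simp add: free_op_mult power2_eq_square field_simps)

lemma uq_op_equit_Z_nth:
  assumes "q \<noteq> 0" "qn \<noteq> 0" "q\<^sup>2 \<noteq> 1"
  shows "fps_nth (uq_op q qn (equit_Z q qh) f) n = qn\<^sup>2 / q ^ (2 * n) * fps_nth f n +
    qh * qn / q * (1 - 1 / q ^ (2 * Suc n)) * fps_nth f (Suc n)"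
proof -
  have d: "q - inverse q \<noteq> 0" using assms by (simp add: field_simps power2_eq_square)
  have e: "(1 - inverse (q\<^sup>2)) * (1 / (q - inverse q)) = 1 / q"
    using d assms(1) by (simp add: field_simps power2_eq_square)
  have "fps_nth (uq_op q qn (equit_Z q qh) f) n = qn\<^sup>2 / q ^ (2 * n) * fps_nth f n +
    ((1 - inverse (q\<^sup>2)) * (1 / (q - inverse q))) * (qh * qn) *
      (q ^ Suc n - 1 / q ^ Suc n) / q ^ Suc n * fps_nth f (Suc n)"
    unfolding equit_Z_class uq_op_class[OF assms] mult_2 power_add
    by (simp add: free_op_add free_op_mult power_inverse power2_eq_square
      divide_inverse algebra_simps)
  also have "\<dots> = qn\<^sup>2 / q ^ (2 * n) * fps_nth f n +
    qh * qn / q * (1 - 1 / q ^ (2 * Suc n)) * fps_nth f (Suc n)"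
    unfolding e mult_2 power_add using assms(1) by (simp add: field_simps)
  finally show ?thesis .
qed

text \<open>The diagonal entries of X and Y are inverse to each other, so 1 - XY is purely
  raising.\<close>

lemma one_minus_equit_XY_nth:
  assumes "q \<noteq> 0" "qn \<noteq> 0" "q\<^sup>2 \<noteq> 1"
  shows "fps_nth f n - fps_nth (uq_op q qn (equit_X q qh) (uq_op q qn (equit_Y q) f)) n =
    (if n = 0 then 0 else qh * (qn - q ^ (2 * (n - 1)) / qn ^ 3) * fps_nth f (n - 1))"
proof -
  have "qh * (qn ^ 3 / x - 1 / qn) * (x / qn\<^sup>2 * y) = qh * (qn - x / qn ^ 3) * y"
    if "x \<noteq> 0" for x y
    using assms(2) that by (simp add: field_simps power2_eq_square power3_eq_cube)
  then show ?thesis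
    using assms(1,2)
    by (simp add: uq_op_equit_X_nth[OF assms] uq_op_equit_Y_nth[OF assms])
qed

text \<open>The diagonals cancel again, so 1 - YZ is purely lowering. Its factor vanishes where the
  target degree would be -1.\<close>

lemma one_minus_equit_YZ_nth:
  assumes "q \<noteq> 0" "qn \<noteq> 0" "q\<^sup>2 \<noteq> 1"
  shows "fps_nth f n - fps_nth (uq_op q qn (equit_Y q) (uq_op q qn (equit_Z q qh) f)) n =
    - qh / (q ^ 3 * qn) * (q ^ (2 * Suc n) - 1) * fps_nth f (Suc n)"
proof -
  have "x / qn\<^sup>2 * (qn\<^sup>2 / x * u + qh * qn / q * (1 - 1 / (q\<^sup>2 * x)) * v) =
      u - - qh / (q ^ 3 * qn) * (q\<^sup>2 * x - 1) * v" if "x \<noteq> 0" for x u v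
    using assms(1,2) that by (simp add: field_simps power2_eq_square power3_eq_cube)
  from this[of "q ^ (2 * n)"] show ?thesis
    using assms(1,2)
    by (simp add: uq_op_equit_Y_nth[OF assms] uq_op_equit_Z_nth[OF assms] power2_eq_square
      mult.assoc)
qed

section \<open>Identities between the scalars\<close>

text \<open>Odd powers of q^(1/2) keep a single \<open>qh\<close>; the rest is absorbed into
  \<open>q\<close> by \<open>qh\<^sup>2 = q\<close>.\<close>

lemma qpow_collect:
  assumes "qh \<noteq> 0" "qn \<noteq> 0" "qh\<^sup>2 = q"
  shows "qpow qh qn 3 1 = q * qh * qn" "qpow qh qn (-3) (-1) = 1 / (q * qh * qn)"
    "qpow qh qn 1 1 = qh * qn" "qpow qh qn 3 (-1) = q * qh / qn"
    "qpow qh qn 1 (-1) = qh / qn" "qpow qh qn 2 2 = q * qn\<^sup>2"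
    "qpow qh qn (-2) (-2) = 1 / (q * qn\<^sup>2)"
  unfolding assms(3)[symmetric] using assms(1,2)
  by (simp_all add: qpow_def power_int_def eval_nat_numeral field_simps)

text \<open>These are all the facts about \<alpha>, \<beta>, \<delta> that the comparison of entries
  uses. The third is the vanishing of the x-free term on the diagonal.\<close>

lemma alpha_beta_relations:
  fixes q qh qn a b c \<alpha> \<beta> \<delta> :: complex
  assumes nz: "q \<noteq> 0" "qh \<noteq> 0" "qn \<noteq> 0" "a \<noteq> 0" "b \<noteq> 0" "c \<noteq> 0"
    and half: "qh\<^sup>2 = q" and q4: "q ^ 4 \<noteq> 1"
    and \<alpha>: "\<alpha> = - (q * (q * qh * qn * a * b - 1 / (q * qh * qn) * inverse c)) /
                   (q\<^sup>2 - inverse (q\<^sup>2))"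
    and \<beta>: "\<beta> = (qh * qn * a * b - q * qh / qn * inverse c) / (q\<^sup>2 - inverse (q\<^sup>2))"
    and \<delta>: "\<delta> = (q * qn\<^sup>2 * a + 1 / (q * qn\<^sup>2) * inverse a
                    + b * c + inverse b * inverse c) / (q + inverse q)"
  shows "\<alpha> + q\<^sup>2 * \<beta> = - q * qh / (c * qn)"
    and "\<alpha> + \<beta> / q\<^sup>2 = - a * b * qh * qn"
    and "(\<alpha> + \<beta>) * (qh * qn / (b * q) + c * qh / (a * q\<^sup>2 * qn)) + \<delta> = 0"
proof -
  define D where "D = q\<^sup>2 - inverse (q\<^sup>2)"
  have D: "D \<noteq> 0" using q4 nz(1) by (simp add: D_def field_simps flip: power_add)
  \<comment> \<open>Moves \<open>qh\<close> to the numerator, so that it cancels as a common factor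
    below.\<close>
  have ih: "1 / (q * qh * qn) = qh / (q\<^sup>2 * qn)"
    using nz by (simp add: eval_nat_numeral field_simps flip: half)
  have \<alpha>D: "\<alpha> * D = - (q * (q * qh * qn * a * b - qh / (q\<^sup>2 * qn * c)))"
    unfolding \<alpha> ih D_def[symmetric] using D by (simp add: inverse_eq_divide)
  have \<beta>D: "\<beta> * D = qh * qn * a * b - q * qh / (qn * c)"
    unfolding \<beta> D_def[symmetric] using D by (simp add: inverse_eq_divide)
  have "(\<alpha> + q\<^sup>2 * \<beta>) * D = \<alpha> * D + q\<^sup>2 * (\<beta> * D)" by (simp add: algebra_simps)
  also have "\<dots> = - q * qh / (c * qn) * D"
    unfolding \<alpha>D \<beta>D unfolding D_def using nz by (simp add: field_simps power2_eq_square)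
  finally show "\<alpha> + q\<^sup>2 * \<beta> = - q * qh / (c * qn)"
    by (rule mult_right_cancel[OF D, THEN iffD1])
  have "(\<alpha> + \<beta> / q\<^sup>2) * D = \<alpha> * D + (\<beta> * D) / q\<^sup>2" by (simp add: field_simps)
  also have "\<dots> = - a * b * qh * qn * D"
    unfolding \<alpha>D \<beta>D unfolding D_def using nz by (simp add: field_simps power2_eq_square)
  finally show "\<alpha> + \<beta> / q\<^sup>2 = - a * b * qh * qn"
    by (rule mult_right_cancel[OF D, THEN iffD1])
  define E where "E = q + inverse q"
  have DE: "D = (q - inverse q) * E"
    by (simp add: D_def E_def algebra_simps power2_eq_square)
  have E: "E \<noteq> 0" and m: "q - inverse q \<noteq> 0" using D unfolding DE by simp_all
  \<comment> \<open>The numerator of \<alpha> + \<beta> is divisible by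
    \<open>q - inverse q\<close>, which leaves \<open>E\<close>, the denominator of
    \<delta>.\<close>
  have "(\<alpha> + \<beta>) * E * (q - inverse q) = \<alpha> * D + \<beta> * D" unfolding DE by (simp add: algebra_simps)
  also have "\<dots> = - (q * qh * qn * a * b + qh / (qn * c)) * (q - inverse q)"
    unfolding \<alpha>D \<beta>D using nz by (simp add: field_simps power2_eq_square)
  finally have S: "(\<alpha> + \<beta>) * E = - (q * qh * qn * a * b + qh / (qn * c))"
    by (rule mult_right_cancel[OF m, THEN iffD1])
  have \<delta>E: "\<delta> * E = q * qn\<^sup>2 * a + 1 / (q * qn\<^sup>2 * a) + b * c + 1 / (b * c)"
    unfolding \<delta> E_def[symmetric] using E by (simp add: inverse_eq_divide)
  have h: "qh * (qh * x) = q * x" for x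
    unfolding half[symmetric] by (simp only: power2_eq_square mult.assoc)
  have "((\<alpha> + \<beta>) * (qh * qn / (b * q) + c * qh / (a * q\<^sup>2 * qn)) + \<delta>) * E =
      ((\<alpha> + \<beta>) * E) * (qh * qn / (b * q) + c * qh / (a * q\<^sup>2 * qn)) + \<delta> * E"
    by (simp add: algebra_simps)
  also have "\<dots> = 0"
  proof -
    \<comment> \<open>The product of the two binomials expands into exactly the four terms of the
      numerator of \<delta>.\<close>
    have "q * qh * qn * a * b * (qh * qn / (b * q)) = q * qn\<^sup>2 * a"
      "q * qh * qn * a * b * (c * qh / (a * q\<^sup>2 * qn)) = b * c"
      "qh / (qn * c) * (qh * qn / (b * q)) = 1 / (b * c)"
      "qh / (qn * c) * (c * qh / (a * q\<^sup>2 * qn)) = 1 / (q * qn\<^sup>2 * a)"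
      using nz by (simp_all add: field_simps power2_eq_square h)
    then have "(q * qh * qn * a * b + qh / (qn * c)) *
        (qh * qn / (b * q) + c * qh / (a * q\<^sup>2 * qn)) =
        q * qn\<^sup>2 * a + 1 / (q * qn\<^sup>2 * a) + b * c + 1 / (b * c)"
      by (simp only: distrib_left distrib_right) simp
    then show ?thesis unfolding S \<delta>E minus_mult_left[symmetric] by simp
  qed
  finally show "(\<alpha> + \<beta>) * (qh * qn / (b * q) + c * qh / (a * q\<^sup>2 * qn)) + \<delta> = 0" using E by simp
qed

section \<open>Comparison of the entries of both sides\<close>

theorem lemma4p1:
  fixes q \<nu> qh qn a b c \<alpha> \<beta> \<gamma> \<delta> :: complex
    and U (structure)
    and Xe Ye Ze A B :: "uq_free set"
    and O\<^sub>z :: "complex fps \<Rightarrow> complex fps"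
  assumes q_nz: "q \<noteq> 0"
    and q_not_root: "\<And>n::nat. n > 0 \<Longrightarrow> q ^ n \<noteq> 1"
    and nu: "\<And>n::nat. 2 * \<nu> \<noteq> of_nat n"
    and qh: "is_cpow_value q (1/2) qh"
    and qn: "is_cpow_value q \<nu> qn"
    and abc: "a \<noteq> 0" "b \<noteq> 0" "c \<noteq> 0"
    and U: "U = Uq q"
    and Xe: "Xe = equit_X q qh"
    and Ye: "Ye = equit_Y q"
    and Ze: "Ze = equit_Z q qh"
    and A: "A = a \<odot> Xe \<oplus> inverse a \<odot> Ye \<oplus> (q * b * inverse c) \<odot> (\<one> \<ominus> Xe \<otimes> Ye)"
    and B: "B = b \<odot> Ye \<oplus> inverse b \<odot> Ze \<oplus> (q * c * inverse a) \<odot> (\<one> \<ominus> Ye \<otimes> Ze)"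
    and O\<^sub>z: "O\<^sub>z = (\<lambda>f. fps_X * f)"
    and \<alpha>: "\<alpha> = - (q * (qpow qh qn 3 1 * a * b - qpow qh qn (-3) (-1) * inverse c)) /
                   (q\<^sup>2 - inverse (q\<^sup>2))"
    and \<beta>: "\<beta> = (qpow qh qn 1 1 * a * b - qpow qh qn 3 (-1) * inverse c) /
                   (q\<^sup>2 - inverse (q\<^sup>2))"
    and \<gamma>: "\<gamma> = b * inverse c * qpow qh qn 3 1 + a * qpow qh qn 1 (-1)"
    and \<delta>: "\<delta> = (qpow qh qn 2 2 * a + qpow qh qn (-2) (-2) * inverse a
                    + b * c + inverse b * inverse c) / (q + inverse q)"
  shows "uq_op q qn A =
    (\<lambda>f. fps_const \<alpha> * O\<^sub>z (uq_op q qn B f) + fps_const \<beta> * uq_op q qn B (O\<^sub>z f)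
         + fps_const \<gamma> * O\<^sub>z f + fps_const \<delta> * f)"
proof (rule ext, rule fps_ext)
  fix f :: "complex fps" and n :: nat
  have q2: "q\<^sup>2 \<noteq> 1" and q4: "q ^ 4 \<noteq> 1" using q_not_root[of 2] q_not_root[of 4] by simp_all
  have qn_nz: "qn \<noteq> 0" and qh_nz: "qh \<noteq> 0"
    using is_cpow_value_nonzero qn qh by blast+
  note ok = q_nz qn_nz q2
  have half: "qh\<^sup>2 = q" using qh by (rule is_cpow_value_half_square)
  note pw = qpow_collect[OF qh_nz qn_nz half]
  note rel = alpha_beta_relations[OF q_nz qh_nz qn_nz abc half q4
      \<alpha>[unfolded pw] \<beta>[unfolded pw] \<delta>[unfolded pw]]
  \<comment> \<open>Opaque representatives: A and B then expand only down to the operators of X, Y,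
    Z, whose entries are already known.\<close>
  obtain x y z where cl: "Xe = uq_class q x" "Ye = uq_class q y" "Ze = uq_class q z"
    unfolding Xe Ye Ze equit_X_class equit_Y_class equit_Z_class by blast
  have op: "free_op q qn x = uq_op q qn (equit_X q qh)"
    "free_op q qn y = uq_op q qn (equit_Y q)" "free_op q qn z = uq_op q qn (equit_Z q qh)"
    using uq_op_class[OF ok] cl Xe Ye Ze by metis+
  note expand = U cl Uq_class_mult Uq_class_smult Uq_class_diff Uq_class_add Uq_class_one
    uq_op_class[OF ok] free_op_add free_op_diff free_op_mult op
  have A_nth: "fps_nth (uq_op q qn A g) m =
      (a * qn\<^sup>2 / q ^ (2 * m) + q ^ (2 * m) / (a * qn\<^sup>2)) * fps_nth g m +
      (if m = 0 then 0 else
        (- a * qh * (qn ^ 3 / q ^ (2 * (m - 1)) - 1 / qn) +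
          q * b / c * qh * (qn - q ^ (2 * (m - 1)) / qn ^ 3)) * fps_nth g (m - 1))" for g m
  proof -
    have A': "fps_nth (uq_op q qn A g) m = a * fps_nth (uq_op q qn (equit_X q qh) g) m +
        inverse a * fps_nth (uq_op q qn (equit_Y q) g) m + q * b * inverse c *
        (fps_nth g m - fps_nth (uq_op q qn (equit_X q qh) (uq_op q qn (equit_Y q) g)) m)"
      unfolding A by (simp add: expand)
    show ?thesis
      unfolding A' one_minus_equit_XY_nth[OF ok]
      unfolding uq_op_equit_X_nth[OF ok] uq_op_equit_Y_nth[OF ok]
      by (simp add: divide_inverse algebra_simps)
  qed
  have B_nth: "fps_nth (uq_op q qn B g) m =
      (b * q ^ (2 * m) / qn\<^sup>2 + qn\<^sup>2 / (b * q ^ (2 * m))) * fps_nth g m +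
      (qh * qn / (b * q) * (1 - 1 / q ^ (2 * Suc m)) -
        c * qh / (a * q\<^sup>2 * qn) * (q ^ (2 * Suc m) - 1)) * fps_nth g (Suc m)" for g m
  proof -
    have B': "fps_nth (uq_op q qn B g) m = b * fps_nth (uq_op q qn (equit_Y q) g) m +
        inverse b * fps_nth (uq_op q qn (equit_Z q qh) g) m + q * c * inverse a *
        (fps_nth g m - fps_nth (uq_op q qn (equit_Y q) (uq_op q qn (equit_Z q qh) g)) m)"
      unfolding B by (simp add: expand)
    have "q * c * inverse a * (- qh / (q ^ 3 * qn) * u) = - (c * qh / (a * q\<^sup>2 * qn) * u)" for u
      using q_nz qn_nz abc by (simp add: field_simps power2_eq_square power3_eq_cube)
    then have YZ: "q * c * inverse a * (- qh / (q ^ 3 * qn) * u * w) =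
        - (c * qh / (a * q\<^sup>2 * qn) * u * w)" for u w
      by (metis mult.assoc mult_minus_left)
    show ?thesis
      unfolding B' one_minus_equit_YZ_nth[OF ok] YZ
      unfolding uq_op_equit_Y_nth[OF ok] uq_op_equit_Z_nth[OF ok]
      by (simp add: divide_inverse algebra_simps del: power_Suc mult_Suc_right)
  qed
  \<comment> \<open>Entries from degree m to m + 1, with x = q^(2m). The diagonal of B is read at
    degree m in O B, but at degree m + 1 in B O, hence \<open>q\<^sup>2 * x\<close>.\<close>
  have raise: "\<alpha> * (b * x / qn\<^sup>2 + qn\<^sup>2 / (b * x)) +
      \<beta> * (b * (q\<^sup>2 * x) / qn\<^sup>2 + qn\<^sup>2 / (b * (q\<^sup>2 * x))) + \<gamma> =
      - a * qh * (qn ^ 3 / x - 1 / qn) + q * b / c * qh * (qn - x / qn ^ 3)"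
    if "x \<noteq> 0" for x
  proof -
    have "\<alpha> * (b * x / qn\<^sup>2 + qn\<^sup>2 / (b * x)) +
      \<beta> * (b * (q\<^sup>2 * x) / qn\<^sup>2 + qn\<^sup>2 / (b * (q\<^sup>2 * x))) + \<gamma> =
      (\<alpha> + q\<^sup>2 * \<beta>) * (b * x / qn\<^sup>2) + (\<alpha> + \<beta> / q\<^sup>2) * (qn\<^sup>2 / (b * x)) + \<gamma>"
      by (simp add: divide_inverse algebra_simps)
    also have "\<dots> = - a * qh * (qn ^ 3 / x - 1 / qn) + q * b / c * qh * (qn - x / qn ^ 3)"
    proof -
      have mono: "- q * qh / (c * qn) * (b * x / qn\<^sup>2) = - (q * b / c * qh * (x / qn ^ 3))"
        "- a * b * qh * qn * (qn\<^sup>2 / (b * x)) = - (a * qh * (qn ^ 3 / x))"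
        using qn_nz abc that by (simp_all add: field_simps power2_eq_square power3_eq_cube)
      show ?thesis
        unfolding rel mono \<gamma>[unfolded pw] by (simp add: divide_inverse algebra_simps)
    qed
    finally show ?thesis .
  qed
  \<comment> \<open>Entries from degree n to n, with x = q^(2n): O B lowers from degree n and raises
    back, while B O raises first and lowers from degree n + 1.\<close>
  have diagonal: "\<alpha> * (qh * qn / (b * q) * (1 - 1 / x) - c * qh / (a * q\<^sup>2 * qn) * (x - 1)) +
      \<beta> * (qh * qn / (b * q) * (1 - 1 / (q\<^sup>2 * x)) - c * qh / (a * q\<^sup>2 * qn) * (q\<^sup>2 * x - 1)) + \<delta> =
      a * qn\<^sup>2 / x + x / (a * qn\<^sup>2)"
    if "x \<noteq> 0" for x
  proof -
    have h: "qh * (qh * y) = q * y" for y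
      unfolding half[symmetric] by (simp only: power2_eq_square mult.assoc)
    have "\<alpha> * (qh * qn / (b * q) * (1 - 1 / x) - c * qh / (a * q\<^sup>2 * qn) * (x - 1)) +
      \<beta> * (qh * qn / (b * q) * (1 - 1 / (q\<^sup>2 * x)) - c * qh / (a * q\<^sup>2 * qn) * (q\<^sup>2 * x - 1)) + \<delta> =
      ((\<alpha> + \<beta>) * (qh * qn / (b * q) + c * qh / (a * q\<^sup>2 * qn)) + \<delta>) -
      (\<alpha> + \<beta> / q\<^sup>2) * (qh * qn / (b * q) / x) -
      (\<alpha> + q\<^sup>2 * \<beta>) * (c * qh / (a * q\<^sup>2 * qn) * x)"
      by (simp add: divide_inverse algebra_simps)
    also have "\<dots> = a * qn\<^sup>2 / x + x / (a * qn\<^sup>2)"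
    proof -
      have mono: "- a * b * qh * qn * (qh * qn / (b * q) / x) = - (a * qn\<^sup>2 / x)"
        "- q * qh / (c * qn) * (c * qh / (a * q\<^sup>2 * qn) * x) = - (x / (a * qn\<^sup>2))"
        using q_nz qn_nz abc that by (simp_all add: field_simps power2_eq_square h)
      show ?thesis unfolding rel mono by simp
    qed
    finally show ?thesis .
  qed
  show "fps_nth (uq_op q qn A f) n =
    fps_nth (fps_const \<alpha> * O\<^sub>z (uq_op q qn B f) + fps_const \<beta> * uq_op q qn B (O\<^sub>z f)
         + fps_const \<gamma> * O\<^sub>z f + fps_const \<delta> * f) n"
  proof (cases n)
    case 0
    \<comment> \<open>In degree 0 the term O B contributes nothing. This agrees with
      \<open>diagonal\<close> at x = 1, where \<open>1 - 1 / x\<close> and \<open>x - 1\<close>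
      vanish; the 1s are left visible to match that instance.\<close>
    have A_0: "fps_nth (uq_op q qn A f) 0 =
        (a * qn\<^sup>2 / 1 + 1 / (a * qn\<^sup>2)) * fps_nth f 0"
      by (simp add: A_nth)
    have p: "q ^ (2 * Suc 0) = q\<^sup>2 * 1"
      by simp
    show ?thesis
      unfolding 0 A_0 diagonal[OF one_neq_zero, symmetric]
      unfolding O\<^sub>z fps_add_nth fps_mult_left_const_nth B_nth p
      by (simp add: algebra_simps)
  next
    case (Suc m)
    \<comment> \<open>For the coefficient of degree m + 1, \<open>raise\<close> applies at
      \<open>x\<close> and \<open>diagonal\<close> at \<open>q\<^sup>2 * x\<close>.\<close>
    define x where "x = q ^ (2 * m)"
    have x: "x \<noteq> 0" "q\<^sup>2 * x \<noteq> 0" using q_nz by (simp_all add: x_def)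
    have p: "q ^ (2 * Suc m) = q\<^sup>2 * x" "q ^ (2 * Suc (Suc m)) = q\<^sup>2 * (q\<^sup>2 * x)"
      by (simp_all add: x_def power2_eq_square)
    have A_Suc: "fps_nth (uq_op q qn A f) (Suc m) =
        (a * qn\<^sup>2 / (q\<^sup>2 * x) + q\<^sup>2 * x / (a * qn\<^sup>2)) * fps_nth f (Suc m) +
        (- a * qh * (qn ^ 3 / x - 1 / qn) + q * b / c * qh * (qn - x / qn ^ 3)) * fps_nth f m"
      unfolding A_nth p by (simp add: x_def)
    show ?thesis
      unfolding Suc A_Suc raise[OF x(1), symmetric] diagonal[OF x(2), symmetric]
      unfolding O\<^sub>z fps_add_nth fps_mult_left_const_nth B_nth p
      by (simp add: B_nth[of f m, unfolded p, folded x_def] algebra_simps flip: x_def)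
  qed
qed

end
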